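(* Let $(\mathcal{A},\cdot)$ be a commutative and associative algebra, let $\mathcal{D}\subset\mathrm{Der}(\mathcal{A})$ be a subspace stable under the commutator $[\cdot,\cdot]_\circ$ of the composition product, and let $\diamond:\mathcal{D}\otimes\mathcal{D}\to\mathcal{D}$ be a bilinear operation. On $\mathcal{A}\otimes\mathcal{D}$ define, for $a_1,a_2\in\mathcal{A}$, $D_1,D_2\in\mathcal{D}$, $$(a_1\otimes D_1)\blacktriangleright(a_2\otimes D_2):=a_1D_1(a_2)\otimes D_2+a_1a_2\otimes(D_1\diamond D_2),$$ $$[a_1\otimes D_1,a_2\otimes D_2]^{\mathrm d}:=a_1a_2\otimes\big([D_1,D_2]_\circ-[D_1,D_2]_\diamond\big).$$ If $\mathbf{R}^{\diamond,[\cdot,\cdot]_\circ}\equiv0$ and $\diamond\,\mathbf{T}^{\diamond,[\cdot,\cdot]_\circ}\equiv0$, then $(\mathcal{A}\otimes\mathcal{D},\blacktriangleright,[\cdot,\cdot]^{\mathrm d})$ is a post-Lie algebra.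
   Context: Vector spaces are over $\mathbb{R}$. $\mathrm{Der}(\mathcal{A})$ is the space of linear maps $D:\mathcal{A}\to\mathcal{A}$ with $D(ab)=D(a)b+aD(b)$. For a bilinear operation $\ast$: $[x,y]_\ast:=x\ast y-y\ast x$ and $\mathsf{a}_\ast(x,y,z):=x\ast(y\ast z)-(x\ast y)\ast z$. A (left) post-Lie algebra $(L,\triangleright,[\cdot,\cdot])$ is a vector space with bilinear operations such that $[\cdot,\cdot]$ is a Lie bracket, $x\triangleright[y,z]=[x\triangleright y,z]+[y,x\triangleright z]$ and $[x,y]\triangleright z=\mathsf{a}_\triangleright(x,y,z)-\mathsf{a}_\triangleright(y,x,z)$. On the Lie algebra $(\mathcal{D},[\cdot,\cdot]_\circ)$: torsion $\mathbf{T}^{\diamond,[\cdot,\cdot]_\circ}(D_1,D_2):=[D_1,D_2]_\diamond-[D_1,D_2]_\circ$; curvature $\mathbf{R}^{\diamond,[\cdot,\cdot]_\circ}(D_1,D_2,D_3):=D_1\diamond(D_2\diamond D_3)-D_2\diamond(D_1\diamond D_3)-[D_1,D_2]_\circ\diamond D_3$; and $\diamond\,\mathbf{T}\equiv0$ means $D_1\diamond\mathbf{T}(D_2,D_3)-\mathbf{T}(D_1\diamond D_2,D_3)-\mathbf{T}(D_2,D_1\diamond D_3)=0$ for all $D_1,D_2,D_3\in\mathcal{D}$. *)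

theory Defs
  imports "HOL-Analysis.Analysis" "HOL-Analysis.Finite_Function_Topology" "HOL-Library.Function_Algebras"
begin

text \<open>Addition, subtraction and zero on functions are the pointwise ones of
  \<open>HOL-Library.Function_Algebras\<close>. A vector space \<open>D\<close> of linear endomorphisms is thus
  a \<open>subspace D\<close> of the type of all functions.\<close>

instantiation "fun" :: (type, real_vector) real_vector
begin

definition scaleR_fun :: "real \<Rightarrow> ('a \<Rightarrow> 'b) \<Rightarrow> 'a \<Rightarrow> 'b"
  where "scaleR_fun r f = (\<lambda>x. r *\<^sub>R f x)"

instance
  by standard (auto simp: scaleR_fun_def fun_eq_iff scaleR_add_left scaleR_add_right)

end

lemma scaleR_fun_apply [simp]: "(r *\<^sub>R f) x = r *\<^sub>R f x"
  by (simp add: scaleR_fun_def)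

definition bilinear_on ::
  "'a::real_vector set \<Rightarrow> 'b::real_vector set \<Rightarrow> 'c::real_vector set \<Rightarrow> ('a \<Rightarrow> 'b \<Rightarrow> 'c) \<Rightarrow> bool"
  where "bilinear_on S T U f \<longleftrightarrow>
    (\<forall>x\<in>S. \<forall>y\<in>T. f x y \<in> U) \<and>
    (\<forall>x\<in>S. \<forall>x'\<in>S. \<forall>y\<in>T. f (x + x') y = f x y + f x' y) \<and>
    (\<forall>x\<in>S. \<forall>y\<in>T. \<forall>y'\<in>T. f x (y + y') = f x y + f x y') \<and>
    (\<forall>r. \<forall>x\<in>S. \<forall>y\<in>T. f (r *\<^sub>R x) y = r *\<^sub>R f x y) \<and>
    (\<forall>r. \<forall>x\<in>S. \<forall>y\<in>T. f x (r *\<^sub>R y) = r *\<^sub>R f x y)"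

text \<open>The tensor product of two real vector spaces (types) is the free vector space on the
  pairs modulo the bilinearity relations.\<close>

definition pure :: "'a \<Rightarrow> 'b \<Rightarrow> ('a \<times> 'b) \<Rightarrow>\<^sub>0 real"
  where "pure x y = Poly_Mapping.single (x, y) 1"

definition tensor_relators :: "(('a::real_vector \<times> 'b::real_vector) \<Rightarrow>\<^sub>0 real) set"
  where "tensor_relators =
    {pure (x + x') y - pure x y - pure x' y | x x' y. True} \<union>
    {pure x (y + y') - pure x y - pure x y' | x y y'. True} \<union>
    {pure (r *\<^sub>R x) y - r *\<^sub>R pure x y | r x y. True} \<union>
    {pure x (r *\<^sub>R y) - r *\<^sub>R pure x y | r x y. True}"

quotient_type (overloaded) ('a, 'b) tensor =
    "('a::real_vector \<times> 'b::real_vector) \<Rightarrow>\<^sub>0 real" / "\<lambda>p q. p - q \<in> span tensor_relators"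
proof (rule equivpI)
  show "reflp (\<lambda>p q. p - q \<in> span (tensor_relators :: (('a \<times> 'b) \<Rightarrow>\<^sub>0 real) set))"
    by (auto simp: reflp_def span_zero)
  show "symp (\<lambda>p q. p - q \<in> span (tensor_relators :: (('a \<times> 'b) \<Rightarrow>\<^sub>0 real) set))"
    proof (rule sympI)
    fix p q :: "('a \<times> 'b) \<Rightarrow>\<^sub>0 real"
    assume "p - q \<in> span tensor_relators"
    then have "- (p - q) \<in> span tensor_relators"
      by (rule span_neg)
    then show "q - p \<in> span tensor_relators"
      by simp
  qed
  show "transp (\<lambda>p q. p - q \<in> span (tensor_relators :: (('a \<times> 'b) \<Rightarrow>\<^sub>0 real) set))"
    proof (rule transpI)
    fix p q r :: "('a \<times> 'b) \<Rightarrow>\<^sub>0 real"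
    assume "p - q \<in> span tensor_relators" "q - r \<in> span tensor_relators"
    then have "(p - q) + (q - r) \<in> span tensor_relators"
      by (rule span_add)
    then show "p - r \<in> span tensor_relators"
      by simp
  qed
qed

instantiation tensor :: (real_vector, real_vector) real_vector
begin

lift_definition zero_tensor :: "('a, 'b) tensor" is 0 .

lift_definition plus_tensor :: "('a, 'b) tensor \<Rightarrow> ('a, 'b) tensor \<Rightarrow> ('a, 'b) tensor" is "(+)"
proof -
  fix p q p' q' :: "('a \<times> 'b) \<Rightarrow>\<^sub>0 real"
  assume "p - q \<in> span tensor_relators" "p' - q' \<in> span tensor_relators"
  then have "(p - q) + (p' - q') \<in> span tensor_relators"
    by (rule span_add)
  then show "(p + p') - (q + q') \<in> span tensor_relators"
    by (simp add: algebra_simps)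
qed

lift_definition uminus_tensor :: "('a, 'b) tensor \<Rightarrow> ('a, 'b) tensor" is uminus
proof -
  fix p q :: "('a \<times> 'b) \<Rightarrow>\<^sub>0 real"
  assume "p - q \<in> span tensor_relators"
  then have "- (p - q) \<in> span tensor_relators"
    by (rule span_neg)
  then show "- p - - q \<in> span tensor_relators"
    by simp
qed

lift_definition minus_tensor :: "('a, 'b) tensor \<Rightarrow> ('a, 'b) tensor \<Rightarrow> ('a, 'b) tensor" is "(-)"
proof -
  fix p q p' q' :: "('a \<times> 'b) \<Rightarrow>\<^sub>0 real"
  assume "p - q \<in> span tensor_relators" "p' - q' \<in> span tensor_relators"
  then have "(p - q) - (p' - q') \<in> span tensor_relators"
    by (rule span_diff)
  then show "(p - p') - (q - q') \<in> span tensor_relators"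
    by (simp add: algebra_simps)
qed

lift_definition scaleR_tensor :: "real \<Rightarrow> ('a, 'b) tensor \<Rightarrow> ('a, 'b) tensor" is "(*\<^sub>R)"
  by (simp only: scaleR_right_diff_distrib[symmetric] span_scale)

instance
  by standard (transfer; simp add: algebra_simps span_zero)+

end

lift_definition tensor :: "'a::real_vector \<Rightarrow> 'b::real_vector \<Rightarrow> ('a, 'b) tensor"  (infix \<open>\<otimes>\<close> 75)
  is pure .

text \<open>For subspaces \<open>S\<close> and \<open>T\<close> the tensor product is the span of the pure tensors
  in the tensor product of the ambient spaces. Over a field this is the tensor product of \<open>S\<close> and
  \<open>T\<close>; the universal property is lemma \<open>tensor_space_universal\<close> below.\<close>

definition tensor_space :: "'a::real_vector set \<Rightarrow> 'b::real_vector set \<Rightarrow> ('a, 'b) tensor set"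
  where "tensor_space S T = span {x \<otimes> y | x y. x \<in> S \<and> y \<in> T}"

lemma bilinear_tensor: "bilinear ((\<otimes>) :: 'a::real_vector \<Rightarrow> 'b::real_vector \<Rightarrow> _)"
proof -
  have rel: "p \<in> tensor_relators \<Longrightarrow> p \<in> span tensor_relators"
    for p :: "('a \<times> 'b) \<Rightarrow>\<^sub>0 real"
    by (rule span_base)
  have "(x + x') \<otimes> y = x \<otimes> y + x' \<otimes> y" for x x' :: 'a and y :: 'b
    by transfer (rule rel, unfold tensor_relators_def diff_diff_eq[symmetric], blast)
  moreover have "x \<otimes> (y + y') = x \<otimes> y + x \<otimes> y'" for x :: 'a and y y' :: 'b
    by transfer (rule rel, unfold tensor_relators_def diff_diff_eq[symmetric], blast)
  moreover have "(r *\<^sub>R x) \<otimes> y = r *\<^sub>R (x \<otimes> y)" for r and x :: 'a and y :: 'b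
    by transfer (rule rel, unfold tensor_relators_def, blast)
  moreover have "x \<otimes> (r *\<^sub>R y) = r *\<^sub>R (x \<otimes> y)" for r and x :: 'a and y :: 'b
    by transfer (rule rel, unfold tensor_relators_def, blast)
  ultimately show ?thesis
    by (auto simp: bilinear_def intro!: linearI)
qed

definition free_lift :: "('a \<Rightarrow> 'b \<Rightarrow> 'c::real_vector) \<Rightarrow> (('a \<times> 'b) \<Rightarrow>\<^sub>0 real) \<Rightarrow> 'c"
  where "free_lift f p = (\<Sum>k\<in>Poly_Mapping.keys p. Poly_Mapping.lookup p k *\<^sub>R f (fst k) (snd k))"

lemma lookup_scaleR_real:
  "Poly_Mapping.lookup (r *\<^sub>R p) k = r * Poly_Mapping.lookup (p :: 'a \<Rightarrow>\<^sub>0 real) k"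
  by (simp add: scaleR_poly_mapping_def)

lemma free_lift_superset:
  assumes "finite K" "Poly_Mapping.keys p \<subseteq> K"
  shows "free_lift f p = (\<Sum>k\<in>K. Poly_Mapping.lookup p k *\<^sub>R f (fst k) (snd k))"
  unfolding free_lift_def using assms
  by (intro sum.mono_neutral_left) (auto simp: in_keys_iff)

lemma linear_free_lift: "linear (free_lift f)"
proof (rule linearI)
  fix p q :: "('a \<times> 'b) \<Rightarrow>\<^sub>0 real" and r :: real
  let ?K = "Poly_Mapping.keys p \<union> Poly_Mapping.keys q"
  have "free_lift f (p + q) = (\<Sum>k\<in>?K. Poly_Mapping.lookup (p + q) k *\<^sub>R f (fst k) (snd k))"
    by (rule free_lift_superset) (auto simp: in_keys_iff lookup_add)
  also have "\<dots> = free_lift f p + free_lift f q"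
    by (simp add: free_lift_superset[of ?K p] free_lift_superset[of ?K q] lookup_add
        scaleR_add_left sum.distrib)
  finally show "free_lift f (p + q) = free_lift f p + free_lift f q" .
  have "free_lift f (r *\<^sub>R p) =
      (\<Sum>k\<in>Poly_Mapping.keys p. Poly_Mapping.lookup (r *\<^sub>R p) k *\<^sub>R f (fst k) (snd k))"
    by (rule free_lift_superset) (auto simp: in_keys_iff lookup_scaleR_real)
  then show "free_lift f (r *\<^sub>R p) = r *\<^sub>R free_lift f p"
    by (simp add: free_lift_def lookup_scaleR_real scaleR_sum_right)
qed

lemma free_lift_pure [simp]: "free_lift f (pure x y) = f x y"
  by (simp add: free_lift_def pure_def)

lemma free_lift_relators:
  assumes "bilinear f" "p \<in> span tensor_relators"
  shows "free_lift f p = 0"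
  using assms(2)
proof (rule linear_eq_0_on_span[OF linear_free_lift, rotated])
  fix q :: "('a \<times> 'b) \<Rightarrow>\<^sub>0 real" assume "q \<in> tensor_relators"
  then show "free_lift f q = 0"
    using assms(1)
    by (auto simp: tensor_relators_def linear_diff[OF linear_free_lift]
        linear_scale[OF linear_free_lift] bilinear_ladd bilinear_radd bilinear_lmul bilinear_rmul)
qed

lemma tensor_universal:
  fixes f :: "'a::real_vector \<Rightarrow> 'b::real_vector \<Rightarrow> 'c::real_vector"
  assumes "bilinear f"
  shows "\<exists>g. linear g \<and> (\<forall>x y. g (x \<otimes> y) = f x y)"
proof -
  define g where "g t = free_lift f (rep_tensor t)" for t
  have g: "g (abs_tensor p) = free_lift f p" for p
  proof -
    have "rep_tensor (abs_tensor p) - p \<in> span tensor_relators"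
      using Quotient3_rep_abs[OF Quotient3_tensor] by (simp add: span_zero)
    then show ?thesis
      using free_lift_relators[OF assms] linear_diff[OF linear_free_lift]
      by (metis g_def eq_iff_diff_eq_0)
  qed
  have "linear g"
  proof (rule linearI)
    fix s t :: "('a, 'b) tensor" and r :: real
    obtain p q where pq: "s = abs_tensor p" "t = abs_tensor q"
      by (metis Quotient3_abs_rep[OF Quotient3_tensor])
    show "g (s + t) = g s + g t"
      by (simp add: pq plus_tensor.abs_eq g linear_add[OF linear_free_lift])
    show "g (r *\<^sub>R s) = r *\<^sub>R g s"
      by (simp add: pq scaleR_tensor.abs_eq g linear_scale[OF linear_free_lift])
  qed
  moreover have "g (x \<otimes> y) = f x y" for x y
    by (simp add: tensor.abs_eq g)
  ultimately show ?thesis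
    by blast
qed

lemma tensor_space_universal:
  fixes f :: "'a::real_vector \<Rightarrow> 'b::real_vector \<Rightarrow> 'c::real_vector"
  assumes "subspace S" "subspace T" "bilinear_on S T UNIV f"
  shows "\<exists>g. linear g \<and> (\<forall>x\<in>S. \<forall>y\<in>T. g (x \<otimes> y) = f x y) \<and>
    (\<forall>h. linear h \<and> (\<forall>x\<in>S. \<forall>y\<in>T. h (x \<otimes> y) = f x y) \<longrightarrow>
      (\<forall>t\<in>tensor_space S T. h t = g t))"
proof -
  have proj: "\<exists>\<pi>. linear \<pi> \<and> (\<forall>x. \<pi> x \<in> V) \<and> (\<forall>x\<in>V. \<pi> x = x)" if V: "subspace V"
    for V :: "'v::real_vector set"
  proof -
    obtain \<pi> :: "'v \<Rightarrow> 'v" where "\<pi> ` UNIV \<subseteq> V" "linear \<pi>" "\<forall>x\<in>V. \<pi> (id x) = x"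
      using linear_exists_left_inverse_on[of id V] V by (auto simp: linear_id)
    then show ?thesis
      by (intro exI[of _ \<pi>]) auto
  qed
  obtain \<pi> where \<pi>: "linear \<pi>" "\<And>x. \<pi> x \<in> S" "\<And>x. x \<in> S \<Longrightarrow> \<pi> x = x"
    using proj[OF assms(1)] by blast
  obtain \<rho> where \<rho>: "linear \<rho>" "\<And>y. \<rho> y \<in> T" "\<And>y. y \<in> T \<Longrightarrow> \<rho> y = y"
    using proj[OF assms(2)] by blast
  have "bilinear (\<lambda>x y. f (\<pi> x) (\<rho> y))"
    using assms(3) \<pi>(2) \<rho>(2)
    by (auto simp: bilinear_def bilinear_on_def linear_add[OF \<pi>(1)] linear_add[OF \<rho>(1)]
        linear_scale[OF \<pi>(1)] linear_scale[OF \<rho>(1)] intro!: linearI)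
  from tensor_universal[OF this] obtain g
    where g: "linear g" "\<And>x y. g (x \<otimes> y) = f (\<pi> x) (\<rho> y)"
    by blast
  have gf: "\<forall>x\<in>S. \<forall>y\<in>T. g (x \<otimes> y) = f x y"
    using g(2) \<pi>(3) \<rho>(3) by simp
  have "h t = g t" if "linear h" "\<forall>x\<in>S. \<forall>y\<in>T. h (x \<otimes> y) = f x y" "t \<in> tensor_space S T" for h t
    using that(3) unfolding tensor_space_def
    by (rule linear_eq_on_span[OF that(1) g(1), rotated]) (use that(2) gf in auto)
  with g(1) gf show ?thesis
    by blast
qed

definition commutator :: "('v::real_vector \<Rightarrow> 'v \<Rightarrow> 'v) \<Rightarrow> 'v \<Rightarrow> 'v \<Rightarrow> 'v"
  where "commutator m x y = m x y - m y x"

definition associator :: "('v::real_vector \<Rightarrow> 'v \<Rightarrow> 'v) \<Rightarrow> 'v \<Rightarrow> 'v \<Rightarrow> 'v \<Rightarrow> 'v"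
  where "associator m x y z = m x (m y z) - m (m x y) z"

locale Lie_algebra =
  fixes L :: "'v::real_vector set" and br :: "'v \<Rightarrow> 'v \<Rightarrow> 'v"
  assumes subspace: "subspace L"
    and bracket_bilinear: "bilinear_on L L L br"
    and bracket_alternating: "x \<in> L \<Longrightarrow> br x x = 0"
    and Jacobi: "\<lbrakk>x \<in> L; y \<in> L; z \<in> L\<rbrakk> \<Longrightarrow> br x (br y z) + br y (br z x) + br z (br x y) = 0"

locale post_Lie_algebra = Lie_algebra L br
  for L :: "'v::real_vector set" and tri :: "'v \<Rightarrow> 'v \<Rightarrow> 'v" and br :: "'v \<Rightarrow> 'v \<Rightarrow> 'v" +
  assumes tri_bilinear: "bilinear_on L L L tri"
    and tri_derivation: "\<lbrakk>x \<in> L; y \<in> L; z \<in> L\<rbrakk> \<Longrightarrow>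
      tri x (br y z) = br (tri x y) z + br y (tri x z)"
    and bracket_tri: "\<lbrakk>x \<in> L; y \<in> L; z \<in> L\<rbrakk> \<Longrightarrow>
      tri (br x y) z = associator tri x y z - associator tri y x z"

definition Der :: "('a::real_algebra \<Rightarrow> 'a) set"
  where "Der = {D. linear D \<and> (\<forall>a b. D (a * b) = D a * b + a * D b)}"

definition torsion ::
  "('v::real_vector \<Rightarrow> 'v \<Rightarrow> 'v) \<Rightarrow> ('v \<Rightarrow> 'v \<Rightarrow> 'v) \<Rightarrow> 'v \<Rightarrow> 'v \<Rightarrow> 'v"
  where "torsion dia br x y = commutator dia x y - br x y"

definition curvature ::
  "('v::real_vector \<Rightarrow> 'v \<Rightarrow> 'v) \<Rightarrow> ('v \<Rightarrow> 'v \<Rightarrow> 'v) \<Rightarrow> 'v \<Rightarrow> 'v \<Rightarrow> 'v \<Rightarrow> 'v"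
  where "curvature dia br x y z = dia x (dia y z) - dia y (dia x z) - dia (br x y) z"

definition covariant_derivative_torsion ::
  "('v::real_vector \<Rightarrow> 'v \<Rightarrow> 'v) \<Rightarrow> ('v \<Rightarrow> 'v \<Rightarrow> 'v) \<Rightarrow> 'v \<Rightarrow> 'v \<Rightarrow> 'v \<Rightarrow> 'v"
  where "covariant_derivative_torsion dia br x y z =
    dia x (torsion dia br y z) - torsion dia br (dia x y) z - torsion dia br y (dia x z)"

text \<open>An operation given on pure tensors denotes its bilinear extension to \<open>\<A> \<otimes> \<D>\<close>, where
  \<open>\<A>\<close> is the whole type. The predicates say that the last argument is such an extension;
  it is arbitrary outside the tensor product.\<close>

definition is_tensor_triangle ::
  "('a::{real_algebra,comm_ring} \<Rightarrow> 'a) set \<Rightarrow> (('a \<Rightarrow> 'a) \<Rightarrow> ('a \<Rightarrow> 'a) \<Rightarrow> ('a \<Rightarrow> 'a)) \<Rightarrow>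
    (('a, 'a \<Rightarrow> 'a) tensor \<Rightarrow> ('a, 'a \<Rightarrow> 'a) tensor \<Rightarrow> ('a, 'a \<Rightarrow> 'a) tensor) \<Rightarrow> bool"
  where "is_tensor_triangle \<D> dia tri \<longleftrightarrow>
    bilinear_on (tensor_space UNIV \<D>) (tensor_space UNIV \<D>) (tensor_space UNIV \<D>) tri \<and>
    (\<forall>a1 a2. \<forall>D1\<in>\<D>. \<forall>D2\<in>\<D>.
      tri (a1 \<otimes> D1) (a2 \<otimes> D2) = (a1 * D1 a2) \<otimes> D2 + (a1 * a2) \<otimes> dia D1 D2)"

definition is_tensor_bracket ::
  "('a::{real_algebra,comm_ring} \<Rightarrow> 'a) set \<Rightarrow> (('a \<Rightarrow> 'a) \<Rightarrow> ('a \<Rightarrow> 'a) \<Rightarrow> ('a \<Rightarrow> 'a)) \<Rightarrow>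
    (('a, 'a \<Rightarrow> 'a) tensor \<Rightarrow> ('a, 'a \<Rightarrow> 'a) tensor \<Rightarrow> ('a, 'a \<Rightarrow> 'a) tensor) \<Rightarrow> bool"
  where "is_tensor_bracket \<D> dia br \<longleftrightarrow>
    bilinear_on (tensor_space UNIV \<D>) (tensor_space UNIV \<D>) (tensor_space UNIV \<D>) br \<and>
    (\<forall>a1 a2. \<forall>D1\<in>\<D>. \<forall>D2\<in>\<D>.
      br (a1 \<otimes> D1) (a2 \<otimes> D2) = (a1 * a2) \<otimes> (commutator (\<circ>) D1 D2 - commutator dia D1 D2))"

end

theory Submission
  imports Defs
begin

text \<open>For a flat connection with parallel torsion, the
  first Bianchi identity reduces to the Jacobi identity of the torsion, so \<open>(\<D>, \<diamond>, -T)\<close> is a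
  post-Lie algebra. The \<open>\<A>\<close>-coefficients then add only terms that cancel by the Leibniz rule,
  because \<open>\<A>\<close> is commutative and \<open>[D\<^sub>1, D\<^sub>2]\<^sub>\<circ> = -T(D\<^sub>1, D\<^sub>2) + [D\<^sub>1, D\<^sub>2]\<^sub>\<diamond>\<close> as derivations.
  All identities are multilinear, hence it suffices to check them on pure tensors.\<close>

section \<open>Bilinear maps on subspaces\<close>

lemma bilinear_onI:
  assumes "\<And>x y. x \<in> S \<Longrightarrow> y \<in> T \<Longrightarrow> f x y \<in> U"
    and "\<And>x x' y. x \<in> S \<Longrightarrow> x' \<in> S \<Longrightarrow> y \<in> T \<Longrightarrow> f (x + x') y = f x y + f x' y"
    and "\<And>x y y'. x \<in> S \<Longrightarrow> y \<in> T \<Longrightarrow> y' \<in> T \<Longrightarrow> f x (y + y') = f x y + f x y'"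
    and "\<And>r x y. x \<in> S \<Longrightarrow> y \<in> T \<Longrightarrow> f (r *\<^sub>R x) y = r *\<^sub>R f x y"
    and "\<And>r x y. x \<in> S \<Longrightarrow> y \<in> T \<Longrightarrow> f x (r *\<^sub>R y) = r *\<^sub>R f x y"
  shows "bilinear_on S T U f"
  unfolding bilinear_on_def using assms by blast

lemma bilinear_onD:
  assumes "bilinear_on S T U f"
  shows bilinear_on_mem: "x \<in> S \<Longrightarrow> y \<in> T \<Longrightarrow> f x y \<in> U"
    and bilinear_on_ladd: "x \<in> S \<Longrightarrow> x' \<in> S \<Longrightarrow> y \<in> T \<Longrightarrow> f (x + x') y = f x y + f x' y"
    and bilinear_on_radd: "x \<in> S \<Longrightarrow> y \<in> T \<Longrightarrow> y' \<in> T \<Longrightarrow> f x (y + y') = f x y + f x y'"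
    and bilinear_on_lscale: "x \<in> S \<Longrightarrow> y \<in> T \<Longrightarrow> f (r *\<^sub>R x) y = r *\<^sub>R f x y"
    and bilinear_on_rscale: "x \<in> S \<Longrightarrow> y \<in> T \<Longrightarrow> f x (r *\<^sub>R y) = r *\<^sub>R f x y"
  using assms unfolding bilinear_on_def by blast+

lemma bilinear_on_ldiff:
  assumes "bilinear_on S T U f" "subspace S" "x \<in> S" "x' \<in> S" "y \<in> T"
  shows "f (x - x') y = f x y - f x' y"
  using bilinear_on_ladd[OF assms(1), of "x - x'" x' y] assms by (simp add: subspace_diff)

lemma bilinear_on_rdiff:
  assumes "bilinear_on S T U f" "subspace T" "x \<in> S" "y \<in> T" "y' \<in> T"
  shows "f x (y - y') = f x y - f x y'"
  using bilinear_on_radd[OF assms(1), of x "y - y'" y'] assms by (simp add: subspace_diff)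

lemma bilinear_on_diff:
  assumes "bilinear_on S T U f" "bilinear_on S T U g" "subspace U"
  shows "bilinear_on S T U (\<lambda>x y. f x y - g x y)"
  using assms unfolding bilinear_on_def by (simp add: subspace_diff scaleR_diff_right)

lemma bilinear_on_commutator:
  assumes "bilinear_on S S S f" "subspace S"
  shows "bilinear_on S S S (commutator f)"
  using assms unfolding bilinear_on_def commutator_def by (simp add: subspace_diff scaleR_diff_right)

section \<open>Tensor products\<close>

lemmas tensor_ladd = bilinear_ladd[OF bilinear_tensor]
  and tensor_radd = bilinear_radd[OF bilinear_tensor]
  and tensor_lscale = bilinear_lmul[OF bilinear_tensor]
  and tensor_rscale = bilinear_rmul[OF bilinear_tensor]
  and tensor_ldiff = bilinear_lsub[OF bilinear_tensor]
  and tensor_rdiff = bilinear_rsub[OF bilinear_tensor]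

lemma subspace_tensor_space: "subspace (tensor_space S T)"
  by (simp add: tensor_space_def)

lemma tensor_in_tensor_space [intro]: "x \<in> S \<Longrightarrow> y \<in> T \<Longrightarrow> x \<otimes> y \<in> tensor_space S T"
  unfolding tensor_space_def by (blast intro: span_base)

text \<open>A scalar can be absorbed into the left factor and \<open>0 = 0 \<otimes> 0\<close>, so
  every element of the span is a finite sum of pure tensors. Hence there is no zero case and no
  scaling case.\<close>

lemma tensor_space_induct [consumes 3, case_names pure add]:
  assumes "t \<in> tensor_space S T" "subspace S" "subspace T"
    and pure: "\<And>x y. x \<in> S \<Longrightarrow> y \<in> T \<Longrightarrow> P (x \<otimes> y)"
    and add: "\<And>s t. s \<in> tensor_space S T \<Longrightarrow> t \<in> tensor_space S T \<Longrightarrow> P s \<Longrightarrow> P t \<Longrightarrow> P (s + t)"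
  shows "P t"
proof -
  have "t \<in> span {x \<otimes> y | x y. x \<in> S \<and> y \<in> T}"
    using assms(1) by (simp add: tensor_space_def)
  then have "t \<in> tensor_space S T \<and> P t"
  proof (induction rule: span_induct_alt)
    case base
    have "0 = (0 :: 'a) \<otimes> (0 :: 'b)"
      by (simp add: bilinear_lzero[OF bilinear_tensor])
    moreover have "P (0 \<otimes> 0)"
      by (rule pure) (use assms(2,3) in \<open>simp_all add: subspace_0\<close>)
    ultimately show ?case
      by (simp add: subspace_0 subspace_tensor_space)
  next
    case (step c u t)
    then obtain x y where u: "u = x \<otimes> y" "x \<in> S" "y \<in> T"
      by blast
    then have cu: "c *\<^sub>R u = (c *\<^sub>R x) \<otimes> y" "c *\<^sub>R x \<in> S"
      using assms(2) by (simp_all add: tensor_lscale subspace_scale)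
    have "c *\<^sub>R u \<in> tensor_space S T" "P (c *\<^sub>R u)"
      unfolding cu(1) using cu(2) u(3) by (blast, rule pure)
    then show ?case
      using step(2) add by (simp add: subspace_add subspace_tensor_space)
  qed
  then show ?thesis ..
qed

section \<open>Extending bilinear maps from pure tensors\<close>

text \<open>The universal property yields maps into a whole type. The smaller codomain is recovered
  here from the values on pure tensors, by additivity in each argument.\<close>

lemma bilinear_on_tensor_space_range:
  assumes f: "bilinear_on (tensor_space S T) (tensor_space S' T') UNIV f"
    and sub: "subspace S" "subspace T" "subspace S'" "subspace T'" "subspace U"
    and pure: "\<And>x y x' y'. x \<in> S \<Longrightarrow> y \<in> T \<Longrightarrow> x' \<in> S' \<Longrightarrow> y' \<in> T' \<Longrightarrow> f (x \<otimes> y) (x' \<otimes> y') \<in> U"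
  shows "bilinear_on (tensor_space S T) (tensor_space S' T') U f"
proof -
  have "f s t \<in> U" if s: "s \<in> tensor_space S T" and t: "t \<in> tensor_space S' T'" for s t
    using s sub(1,2)
  proof (induction rule: tensor_space_induct)
    case (pure x y)
    show ?case
      using t sub(3,4)
      by (induction rule: tensor_space_induct)
        (auto simp: assms(7) pure bilinear_on_radd[OF f] tensor_in_tensor_space subspace_add[OF sub(5)])
  next
    case (add s s')
    then show ?case
      using t by (simp add: bilinear_on_ladd[OF f] subspace_add[OF sub(5)])
  qed
  then show ?thesis
    using f by (simp add: bilinear_on_def)
qed

text \<open>The universal property is applied twice: for fixed \<open>x\<close> and \<open>y\<close>
  it extends \<open>f x y\<close> to a linear map \<open>h x y\<close> on the second tensor product;
  then it extends the function-valued map sending \<open>x\<close>, \<open>y\<close> to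
  \<open>h x y\<close> along the first one.\<close>

lemma tensor_space_bilinear_extension:
  fixes f :: "'a::real_vector \<Rightarrow> 'b::real_vector \<Rightarrow> 'c::real_vector \<Rightarrow> 'd::real_vector \<Rightarrow> 'e::real_vector"
  assumes sub: "subspace S" "subspace T" "subspace S'" "subspace T'"
    and left: "\<And>x' y'. x' \<in> S' \<Longrightarrow> y' \<in> T' \<Longrightarrow> bilinear_on S T UNIV (\<lambda>x y. f x y x' y')"
    and right: "\<And>x y. x \<in> S \<Longrightarrow> y \<in> T \<Longrightarrow> bilinear_on S' T' UNIV (f x y)"
  shows "\<exists>g. bilinear_on (tensor_space S T) (tensor_space S' T') UNIV g \<and>
    (\<forall>x\<in>S. \<forall>y\<in>T. \<forall>x'\<in>S'. \<forall>y'\<in>T'. g (x \<otimes> y) (x' \<otimes> y') = f x y x' y')"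
proof -
  have "\<exists>h. linear h \<and> (\<forall>x'\<in>S'. \<forall>y'\<in>T'. h (x' \<otimes> y') = f x y x' y')" if "x \<in> S" "y \<in> T" for x y
    using tensor_space_universal[OF sub(3,4) right[OF that]] by blast
  then obtain h where lin: "\<And>x y. x \<in> S \<Longrightarrow> y \<in> T \<Longrightarrow> linear (h x y)"
    and h: "\<And>x y x' y'. x \<in> S \<Longrightarrow> y \<in> T \<Longrightarrow> x' \<in> S' \<Longrightarrow> y' \<in> T' \<Longrightarrow> h x y (x' \<otimes> y') = f x y x' y'"
    by metis
  \<comment> \<open>The conditions on \<open>h x y\<close> fix it only on
    \<open>tensor_space S' T'\<close>, so \<open>h\<close> need not depend bilinearly on
    \<open>x\<close> and \<open>y\<close> elsewhere. Replacing it by 0 there makes \<open>k\<close>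
    bilinear as a map into the vector space of functions.\<close>
  define k where "k x y t = (if t \<in> tensor_space S' T' then h x y t else 0)" for x y t
  have k_bilinear: "bilinear_on S T UNIV k"
  proof (rule bilinear_onI)
    fix x x' y assume xy: "x \<in> S" "x' \<in> S" "y \<in> T"
    then have x: "x + x' \<in> S" using sub by (simp add: subspace_add)
    have "h (x + x') y t = h x y t + h x' y t" if "t \<in> tensor_space S' T'" for t
      using that sub(3,4)
      by (induction rule: tensor_space_induct)
        (simp_all add: h xy x bilinear_on_ladd[OF left] linear_add[OF lin])
    then show "k (x + x') y = k x y + k x' y"
      by (auto simp: k_def fun_eq_iff)
  next
    fix x y y' assume xy: "x \<in> S" "y \<in> T" "y' \<in> T"
    then have y: "y + y' \<in> T" using sub by (simp add: subspace_add)
    have "h x (y + y') t = h x y t + h x y' t" if "t \<in> tensor_space S' T'" for t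
      using that sub(3,4)
      by (induction rule: tensor_space_induct)
        (simp_all add: h xy y bilinear_on_radd[OF left] linear_add[OF lin])
    then show "k x (y + y') = k x y + k x y'"
      by (auto simp: k_def fun_eq_iff)
  next
    fix r x y assume xy: "x \<in> S" "y \<in> T"
    then have x: "r *\<^sub>R x \<in> S" using sub by (simp add: subspace_scale)
    have "h (r *\<^sub>R x) y t = r *\<^sub>R h x y t" if "t \<in> tensor_space S' T'" for t
      using that sub(3,4)
      by (induction rule: tensor_space_induct)
        (simp_all add: h xy x bilinear_on_lscale[OF left] linear_add[OF lin] scaleR_add_right)
    then show "k (r *\<^sub>R x) y = r *\<^sub>R k x y"
      by (auto simp: k_def fun_eq_iff)
  next
    fix r x y assume xy: "x \<in> S" "y \<in> T"
    then have y: "r *\<^sub>R y \<in> T" using sub by (simp add: subspace_scale)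
    have "h x (r *\<^sub>R y) t = r *\<^sub>R h x y t" if "t \<in> tensor_space S' T'" for t
      using that sub(3,4)
      by (induction rule: tensor_space_induct)
        (simp_all add: h xy y bilinear_on_rscale[OF left] linear_add[OF lin] scaleR_add_right)
    then show "k x (r *\<^sub>R y) = r *\<^sub>R k x y"
      by (auto simp: k_def fun_eq_iff)
  qed simp
  obtain g where g: "linear g" "\<And>x y. x \<in> S \<Longrightarrow> y \<in> T \<Longrightarrow> g (x \<otimes> y) = k x y"
    using tensor_space_universal[OF sub(1,2) k_bilinear] by blast
  \<comment> \<open>Linearity of \<open>g\<close> concerns the first argument only. In the second it
    is inherited from \<open>h\<close>, by writing \<open>s\<close> as a sum of pure tensors;
    because of the cut-off in \<open>k\<close> it is claimed only on the tensor product.\<close>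
  have add: "g s (t + t') = g s t + g s t'"
    if "s \<in> tensor_space S T" "t \<in> tensor_space S' T'" "t' \<in> tensor_space S' T'" for s t t'
    using that(1) sub(1,2)
    by (induction rule: tensor_space_induct)
      (simp_all add: g k_def that subspace_add subspace_tensor_space linear_add[OF lin] linear_add[OF g(1)])
  have scale: "g s (r *\<^sub>R t) = r *\<^sub>R g s t"
    if "s \<in> tensor_space S T" "t \<in> tensor_space S' T'" for r s t
    using that(1) sub(1,2)
    by (induction rule: tensor_space_induct)
      (simp_all add: g k_def that subspace_scale subspace_tensor_space linear_scale[OF lin]
        linear_add[OF g(1)] scaleR_add_right)
  have "bilinear_on (tensor_space S T) (tensor_space S' T') UNIV g"
    by (rule bilinear_onI) (simp_all add: add scale linear_add[OF g(1)] linear_scale[OF g(1)])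
  moreover have "g (x \<otimes> y) (x' \<otimes> y') = f x y x' y'" if "x \<in> S" "y \<in> T" "x' \<in> S'" "y' \<in> T'" for x y x' y'
    using that by (simp add: g k_def h tensor_in_tensor_space)
  ultimately show ?thesis
    by blast
qed

section \<open>Flat connections with parallel torsion\<close>

text \<open>Composition is always additive in its left factor, and in its right factor once the left
  one is linear. The linear maps in \<open>D\<close> therefore compose as in an associative algebra,
  whose commutator satisfies the Jacobi identity.\<close>

lemma Lie_algebra_endomorphisms:
  fixes D :: "('v::real_vector \<Rightarrow> 'v) set"
  assumes sub: "subspace D" and lin: "\<And>f. f \<in> D \<Longrightarrow> linear f"
    and closed: "\<And>f g. f \<in> D \<Longrightarrow> g \<in> D \<Longrightarrow> commutator (\<circ>) f g \<in> D"
  shows "Lie_algebra D (commutator (\<circ>))"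
proof
  show "bilinear_on D D D (commutator (\<circ>))"
    by (rule bilinear_onI)
      (simp_all add: closed[unfolded commutator_def] commutator_def fun_eq_iff linear_add[OF lin] linear_scale[OF lin] algebra_simps)
qed (use sub in \<open>simp_all add: commutator_def fun_eq_iff linear_diff[OF lin]\<close>)

text \<open>Parallel torsion says that each \<open>dia x\<close> is a derivation of the new bracket.
  Flatness says that \<open>br x y\<close> acts as the commutator of the actions of \<open>x\<close>
  and \<open>y\<close>, which becomes the associator identity once \<open>commutator dia x y\<close>
  is subtracted.\<close>

lemma post_Lie_algebra_flat_parallel_torsion:
  assumes "Lie_algebra L br" and dia: "bilinear_on L L L dia"
    and flat: "\<And>x y z. x \<in> L \<Longrightarrow> y \<in> L \<Longrightarrow> z \<in> L \<Longrightarrow> curvature dia br x y z = 0"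
    and parallel: "\<And>x y z. x \<in> L \<Longrightarrow> y \<in> L \<Longrightarrow> z \<in> L \<Longrightarrow> covariant_derivative_torsion dia br x y z = 0"
  shows "post_Lie_algebra L dia (\<lambda>x y. br x y - commutator dia x y)"
proof -
  interpret Lie_algebra L br by fact
  \<comment> \<open>This is the torsion with its sign reversed.\<close>
  define \<tau> where "\<tau> x y = br x y - commutator dia x y" for x y
  have \<tau>: "bilinear_on L L L \<tau>"
    unfolding \<tau>_def using bracket_bilinear dia subspace
    by (intro bilinear_on_diff bilinear_on_commutator)
  note mem = bilinear_on_mem[OF \<tau>] bilinear_on_mem[OF dia] bilinear_on_mem[OF bracket_bilinear]
    subspace_add[OF subspace] subspace_diff[OF subspace]
  note expand = bilinear_on_ldiff[OF dia subspace] bilinear_on_rdiff[OF dia subspace]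
    bilinear_on_ladd[OF dia] bilinear_on_radd[OF dia] bilinear_on_rdiff[OF \<tau> subspace] bilinear_on_radd[OF \<tau>]
  have br: "br x y = \<tau> x y + dia x y - dia y x" for x y
    by (simp add: \<tau>_def commutator_def)
  \<comment> \<open>Polarization: the alternating law is expanded at \<open>x + y\<close>.\<close>
  have br_skew: "br y x = - br x y" if "x \<in> L" "y \<in> L" for x y
    using bracket_alternating[of "x + y"] bracket_alternating[of x] bracket_alternating[of y] that
    by (simp add: bilinear_on_ladd[OF bracket_bilinear] bilinear_on_radd[OF bracket_bilinear] mem
        eq_neg_iff_add_eq_0 add.commute)
  have skew: "\<tau> y x = - \<tau> x y" if "x \<in> L" "y \<in> L" for x y
    using br_skew[OF that] by (simp add: \<tau>_def commutator_def)
  have deriv: "dia x (\<tau> y z) = \<tau> (dia x y) z + \<tau> y (dia x z)" if "x \<in> L" "y \<in> L" "z \<in> L" for x y z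
  proof -
    \<comment> \<open>The negative is written as a difference from 0 so that
      \<open>bilinear_on_rdiff\<close> applies; \<open>dia x 0 = 0\<close> then comes from scaling
      by 0.\<close>
    have "torsion dia br y z = 0 - \<tau> y z" for y z
      by (simp add: torsion_def \<tau>_def)
    moreover have "dia x (0 - \<tau> y z) = 0 - dia x (\<tau> y z)"
      using bilinear_on_rdiff[OF dia subspace, of x 0 "\<tau> y z"] bilinear_on_rscale[OF dia, of x 0 0]
        that by (simp add: mem subspace_0[OF subspace])
    ultimately show ?thesis
      using parallel[OF that] by (simp add: covariant_derivative_torsion_def algebra_simps)
  qed
  have br_act: "dia (br x y) z = dia x (dia y z) - dia y (dia x z)" if "x \<in> L" "y \<in> L" "z \<in> L" for x y z
    using flat[OF that] by (simp add: curvature_def)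
  \<comment> \<open>In the sum over cyclic permutations of \<open>x\<close>, \<open>y\<close>,
    \<open>z\<close> each of the two bracketed groups cancels: in the first,
    \<open>\<tau> x (dia y z)\<close> against \<open>\<tau> z (dia x y)\<close> and
    \<open>\<tau> x (dia z y)\<close> against \<open>\<tau> y (dia x z)\<close>; in the second,
    \<open>dia x (dia y z)\<close> against \<open>dia y (dia z x)\<close> and
    \<open>dia x (dia z y)\<close> against \<open>dia z (dia y x)\<close>. What remains is the
    Jacobi sum of \<tau>. Skewness moves every \<tau> into this uniform shape.\<close>
  have Bianchi: "br x (br y z) = \<tau> x (\<tau> y z) + (\<tau> x (dia y z) - \<tau> x (dia z y) - \<tau> z (dia x y) + \<tau> y (dia x z))
      + (dia x (dia y z) - dia x (dia z y) - dia y (dia z x) + dia z (dia y x))"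
    if xyz: "x \<in> L" "y \<in> L" "z \<in> L" for x y z
  proof -
    have "br x (br y z) = \<tau> x (br y z) + dia x (br y z) - dia (br y z) x"
      by (rule br)
    moreover have "\<tau> x (br y z) = \<tau> x (\<tau> y z) + \<tau> x (dia y z) - \<tau> x (dia z y)"
      unfolding br[of y z] using xyz by (simp add: expand mem)
    moreover have "dia x (br y z) = \<tau> (dia x y) z + \<tau> y (dia x z) + dia x (dia y z) - dia x (dia z y)"
      unfolding br[of y z] using xyz by (simp add: expand mem deriv)
    ultimately show ?thesis
      using skew[of z "dia x y"] xyz by (simp add: mem br_act)
  qed
  have "post_Lie_algebra L dia \<tau>"
  proof
    show "\<tau> x x = 0" if "x \<in> L" for x
      using bracket_alternating[OF that] by (simp add: \<tau>_def commutator_def)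
    show "\<tau> x (\<tau> y z) + \<tau> y (\<tau> z x) + \<tau> z (\<tau> x y) = 0" if "x \<in> L" "y \<in> L" "z \<in> L" for x y z
      using Jacobi[OF that] Bianchi[of x y z] Bianchi[of y z x] Bianchi[of z x y] that
      by (simp add: algebra_simps)
    show "dia (\<tau> x y) z = associator dia x y z - associator dia y x z" if "x \<in> L" "y \<in> L" "z \<in> L" for x y z
      unfolding \<tau>_def commutator_def associator_def using that by (simp add: expand mem br_act)
  qed (fact subspace \<tau> dia deriv)+
  then show ?thesis
    by (simp add: \<tau>_def[abs_def])
qed

section \<open>The post-Lie algebra on the tensor product\<close>

lemma ex_tensor_triangle:
  fixes \<D> :: "('a::{real_algebra,comm_ring} \<Rightarrow> 'a) set"
  assumes sub: "subspace \<D>" and lin: "\<And>D. D \<in> \<D> \<Longrightarrow> linear D"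
    and dia: "bilinear_on \<D> \<D> \<D> dia"
  shows "\<exists>tri. is_tensor_triangle \<D> dia tri"
proof -
  have "\<exists>g. bilinear_on (tensor_space UNIV \<D>) (tensor_space UNIV \<D>) UNIV g \<and>
    (\<forall>a\<in>(UNIV :: 'a set). \<forall>D\<in>\<D>. \<forall>b\<in>(UNIV :: 'a set). \<forall>E\<in>\<D>. g (a \<otimes> D) (b \<otimes> E) = (a * D b) \<otimes> E + (a * b) \<otimes> dia D E)"
    \<comment> \<open>Linearity of each \<open>D\<close> in \<D> makes the coefficient
      \<open>a * D b\<close> linear in \<open>b\<close>.\<close>
    by (rule tensor_space_bilinear_extension; (intro bilinear_onI)?)
      (simp_all add: sub bilinear_onD[OF dia] linear_add[OF lin] linear_scale[OF lin]
        tensor_ladd tensor_radd tensor_lscale tensor_rscale algebra_simps)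
  then obtain g where g: "bilinear_on (tensor_space UNIV \<D>) (tensor_space UNIV \<D>) UNIV g"
      "\<And>(a :: 'a) (b :: 'a) D E. D \<in> \<D> \<Longrightarrow> E \<in> \<D> \<Longrightarrow> g (a \<otimes> D) (b \<otimes> E) = (a * D b) \<otimes> E + (a * b) \<otimes> dia D E"
    by auto
  from g(1) have "bilinear_on (tensor_space UNIV \<D>) (tensor_space UNIV \<D>) (tensor_space UNIV \<D>) g"
    by (rule bilinear_on_tensor_space_range)
      (auto simp: sub subspace_tensor_space g(2) bilinear_on_mem[OF dia]
        intro!: subspace_add[OF subspace_tensor_space])
  with g(2) show ?thesis
    unfolding is_tensor_triangle_def by blast
qed

lemma ex_tensor_bracket:
  fixes \<D> :: "('a::{real_algebra,comm_ring} \<Rightarrow> 'a) set"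
  assumes sub: "subspace \<D>"
    and br: "bilinear_on \<D> \<D> \<D> (\<lambda>D E. commutator (\<circ>) D E - commutator dia D E)"
  shows "\<exists>br. is_tensor_bracket \<D> dia br"
proof -
  define \<tau> where "\<tau> D E = commutator (\<circ>) D E - commutator dia D E" for D E
  have \<tau>: "bilinear_on \<D> \<D> \<D> \<tau>"
    using br by (simp add: \<tau>_def[abs_def])
  have "\<exists>g. bilinear_on (tensor_space UNIV \<D>) (tensor_space UNIV \<D>) UNIV g \<and>
    (\<forall>a\<in>(UNIV :: 'a set). \<forall>D\<in>\<D>. \<forall>b\<in>(UNIV :: 'a set). \<forall>E\<in>\<D>. g (a \<otimes> D) (b \<otimes> E) = (a * b) \<otimes> \<tau> D E)"
    by (rule tensor_space_bilinear_extension; (intro bilinear_onI)?)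
      (simp_all add: sub bilinear_onD[OF \<tau>] tensor_ladd tensor_radd tensor_lscale tensor_rscale algebra_simps)
  then obtain g where g: "bilinear_on (tensor_space UNIV \<D>) (tensor_space UNIV \<D>) UNIV g"
      "\<And>(a :: 'a) (b :: 'a) D E. D \<in> \<D> \<Longrightarrow> E \<in> \<D> \<Longrightarrow> g (a \<otimes> D) (b \<otimes> E) = (a * b) \<otimes> \<tau> D E"
    by auto
  from g(1) have "bilinear_on (tensor_space UNIV \<D>) (tensor_space UNIV \<D>) (tensor_space UNIV \<D>) g"
    by (rule bilinear_on_tensor_space_range)
      (auto simp: sub subspace_tensor_space g(2) bilinear_on_mem[OF \<tau>])
  with g(2) show ?thesis
    unfolding is_tensor_bracket_def \<tau>_def by blast
qed

section \<open>Trilinear identities on the tensor product\<close>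

text \<open>Three nested inductions, one per argument, reduce an identity that is additive in each
  argument to pure tensors.\<close>

lemma tensor_space_induct3 [consumes 5, case_names pure add1 add2 add3]:
  assumes "u \<in> tensor_space S T" "v \<in> tensor_space S T" "w \<in> tensor_space S T" "subspace S" "subspace T"
    and pure: "\<And>x y x' y' x'' y''. \<lbrakk>x \<in> S; y \<in> T; x' \<in> S; y' \<in> T; x'' \<in> S; y'' \<in> T\<rbrakk> \<Longrightarrow>
      P (x \<otimes> y) (x' \<otimes> y') (x'' \<otimes> y'')"
    and add1: "\<And>u u' v w. \<lbrakk>u \<in> tensor_space S T; u' \<in> tensor_space S T; v \<in> tensor_space S T;
      w \<in> tensor_space S T; P u v w; P u' v w\<rbrakk> \<Longrightarrow> P (u + u') v w"
    and add2: "\<And>u v v' w. \<lbrakk>u \<in> tensor_space S T; v \<in> tensor_space S T; v' \<in> tensor_space S T;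
      w \<in> tensor_space S T; P u v w; P u v' w\<rbrakk> \<Longrightarrow> P u (v + v') w"
    and add3: "\<And>u v w w'. \<lbrakk>u \<in> tensor_space S T; v \<in> tensor_space S T; w \<in> tensor_space S T;
      w' \<in> tensor_space S T; P u v w; P u v w'\<rbrakk> \<Longrightarrow> P u v (w + w')"
  shows "P u v w"
  using assms(1,4,5)
proof (induction rule: tensor_space_induct)
  case xy: (pure x y)
  show ?case
    using assms(2,4,5)
  proof (induction rule: tensor_space_induct)
    case xy': (pure x' y')
    show ?case
      using assms(3,4,5)
    proof (induction rule: tensor_space_induct)
      case (pure x'' y'')
      then show ?case using xy xy' by (intro assms(6))
    next
      case (add s t)
      then show ?case using xy xy' by (intro add3 tensor_in_tensor_space)
    qed
  next
    case (add s t)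
    then show ?case using xy assms(3) by (intro add2 tensor_in_tensor_space)
  qed
next
  case (add s t)
  then show ?case using assms(2,3) by (intro add1)
qed

text \<open>On pure tensors each axiom splits into the same axiom for \<D>, multiplied by the
  product of the coefficients, and terms in which coefficients are differentiated; the latter match
  by the Leibniz rule and commutativity.\<close>

lemma post_Lie_algebra_tensor_space:
  fixes \<D> :: "('a::{real_algebra,comm_ring} \<Rightarrow> 'a) set"
  assumes der: "\<D> \<subseteq> Der"
    and base: "post_Lie_algebra \<D> dia (\<lambda>D E. commutator (\<circ>) D E - commutator dia D E)"
    and tri: "is_tensor_triangle \<D> dia tri" and br: "is_tensor_bracket \<D> dia br"
  shows "post_Lie_algebra (tensor_space UNIV \<D>) tri br"
proof -
  define \<tau> where "\<tau> D E = commutator (\<circ>) D E - commutator dia D E" for D E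
  interpret base: post_Lie_algebra \<D> dia \<tau>
    using base by (simp add: \<tau>_def[abs_def])
  note \<tau> = base.bracket_bilinear and dia = base.tri_bilinear
  let ?M = "tensor_space UNIV \<D>"
  note sub = base.subspace
  have lin: "linear D" and Leibniz: "D (a * b) = D a * b + a * D b" if "D \<in> \<D>" for D a b
    using der that by (auto simp: Der_def)
  have tri_bil: "bilinear_on ?M ?M ?M tri"
    and tri_pure: "\<And>a b D E. D \<in> \<D> \<Longrightarrow> E \<in> \<D> \<Longrightarrow> tri (a \<otimes> D) (b \<otimes> E) = (a * D b) \<otimes> E + (a * b) \<otimes> dia D E"
    using tri by (auto simp: is_tensor_triangle_def)
  have br_bil: "bilinear_on ?M ?M ?M br"
    and br_pure: "\<And>a b D E. D \<in> \<D> \<Longrightarrow> E \<in> \<D> \<Longrightarrow> br (a \<otimes> D) (b \<otimes> E) = (a * b) \<otimes> \<tau> D E"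
    using br by (auto simp: is_tensor_bracket_def \<tau>_def)
  note mem = bilinear_on_mem[OF tri_bil] bilinear_on_mem[OF br_bil] bilinear_on_mem[OF \<tau>] bilinear_on_mem[OF dia]
    subspace_add[OF subspace_tensor_space] tensor_in_tensor_space[OF UNIV_I]
  note expand = bilinear_on_ladd[OF tri_bil] bilinear_on_radd[OF tri_bil]
    bilinear_on_ladd[OF br_bil] bilinear_on_radd[OF br_bil]
  note tensor_expand = tensor_ladd tensor_radd tensor_ldiff tensor_rdiff
  have \<tau>_skew: "\<tau> E D = - \<tau> D E" for D E
    by (simp add: \<tau>_def commutator_def)
  have \<tau>_apply: "\<tau> D E a = D (E a) - E (D a) - dia D E a + dia E D a" for D E a
    by (simp add: \<tau>_def commutator_def)
  \<comment> \<open>The alternating law is quadratic in \<open>s\<close>, so it does not pass to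
    sums directly. Skewness does, and it gives \<open>br s s = 0\<close> after division by
    2.\<close>
  have br_skew: "br s t = - br t s" if s: "s \<in> ?M" and t: "t \<in> ?M" for s t
    using s subspace_UNIV sub
  proof (induction rule: tensor_space_induct)
    case s: (pure a D)
    show ?case
      using t subspace_UNIV sub
    proof (induction rule: tensor_space_induct)
      case (pure b E)
      show ?case
        using s pure \<tau>_skew[of D E] by (simp add: br_pure mult.commute bilinear_rneg[OF bilinear_tensor])
    qed (use s in \<open>simp add: expand mem\<close>)
  qed (use t in \<open>simp add: expand mem\<close>)
  show ?thesis
  proof
    show "br s s = 0" if "s \<in> ?M" for s
    proof -
      have "2 *\<^sub>R br s s = 0"
        using br_skew[OF that that] by (simp add: scaleR_2 eq_neg_iff_add_eq_0)
      then show ?thesis by simp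
    qed
    \<comment> \<open>The identity is solved for one term so that the induction hypotheses serve as
      rewrite rules in the additive cases.\<close>
    have Jacobi: "br u (br v w) = - br v (br w u) - br w (br u v)"
      if "u \<in> ?M" "v \<in> ?M" "w \<in> ?M" for u v w
      using that subspace_UNIV sub
    proof (induction rule: tensor_space_induct3)
      case (pure a D b E c F)
      \<comment> \<open>By commutativity the three double brackets share the coefficient
        \<open>a * b * c\<close>, which leaves the Jacobi sum of \<tau> in the right factor.\<close>
      have "br (a \<otimes> D) (br (b \<otimes> E) (c \<otimes> F)) + br (b \<otimes> E) (br (c \<otimes> F) (a \<otimes> D)) + br (c \<otimes> F) (br (a \<otimes> D) (b \<otimes> E))
          = (a * b * c) \<otimes> (\<tau> D (\<tau> E F) + \<tau> E (\<tau> F D) + \<tau> F (\<tau> D E))"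
        using pure by (simp add: br_pure mem tensor_expand ac_simps)
      also have "\<dots> = 0"
        using pure by (simp add: base.Jacobi bilinear_rzero[OF bilinear_tensor])
      finally show ?case
        by (simp add: algebra_simps eq_neg_iff_add_eq_0)
    qed (simp_all add: expand mem algebra_simps)
    show "br u (br v w) + br v (br w u) + br w (br u v) = 0"
      if "u \<in> ?M" "v \<in> ?M" "w \<in> ?M" for u v w
      by (simp add: Jacobi[OF that])
    show "tri u (br v w) = br (tri u v) w + br v (tri u w)"
      if "u \<in> ?M" "v \<in> ?M" "w \<in> ?M" for u v w
      using that subspace_UNIV sub
    proof (induction rule: tensor_space_induct3)
      case (pure a D b E c F)
      \<comment> \<open>The Leibniz rule splits \<open>a * D (b * c)\<close> into the two
        coefficients produced by letting the left tensor act on each bracket entry.\<close>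
      then show ?case
        by (simp add: tri_pure br_pure mem expand base.tri_derivation Leibniz tensor_expand algebra_simps)
    qed (simp_all add: expand mem algebra_simps)
    show "tri (br u v) w = associator tri u v w - associator tri v u w"
      if "u \<in> ?M" "v \<in> ?M" "w \<in> ?M" for u v w
      using that subspace_UNIV sub
    proof (induction rule: tensor_space_induct3)
      case (pure a D b E c F)
      \<comment> \<open>The mixed terms \<open>(a * b * E c) \<otimes> dia D F\<close> and
        \<open>(a * b * D c) \<otimes> dia E F\<close> are exchanged when the first two arguments
        are swapped, so they cancel in the difference of associators. The terms with right factor
        \<open>F\<close> combine to \<open>(a * b * \<tau> D E c) \<otimes> F\<close> by
        \<open>\<tau>_apply\<close>.\<close>
      then show ?case
        by (simp add: tri_pure br_pure mem expand associator_def Leibniz linear_add[OF lin]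
            base.bracket_tri \<tau>_apply tensor_expand algebra_simps)
    qed (simp_all add: expand mem associator_def)
  qed (fact subspace_tensor_space br_bil tri_bil)+
qed

text \<open>The first conjunct keeps the second from being vacuous. The second ranges over all
  bilinear extensions: they agree on the tensor product, being determined by pure tensors, but may
  differ outside it.\<close>

theorem theorem3p4:
  fixes \<D> :: "('a::{real_algebra,comm_ring} \<Rightarrow> 'a) set"
    and dia :: "('a \<Rightarrow> 'a) \<Rightarrow> ('a \<Rightarrow> 'a) \<Rightarrow> ('a \<Rightarrow> 'a)"
  assumes "subspace \<D>" and "\<D> \<subseteq> Der"
    and "\<And>D1 D2. \<lbrakk>D1 \<in> \<D>; D2 \<in> \<D>\<rbrakk> \<Longrightarrow> commutator (\<circ>) D1 D2 \<in> \<D>"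
    and "bilinear_on \<D> \<D> \<D> dia"
    and "\<And>D1 D2 D3. \<lbrakk>D1 \<in> \<D>; D2 \<in> \<D>; D3 \<in> \<D>\<rbrakk> \<Longrightarrow>
      curvature dia (commutator (\<circ>)) D1 D2 D3 = 0"
    and "\<And>D1 D2 D3. \<lbrakk>D1 \<in> \<D>; D2 \<in> \<D>; D3 \<in> \<D>\<rbrakk> \<Longrightarrow>
      covariant_derivative_torsion dia (commutator (\<circ>)) D1 D2 D3 = 0"
  shows "(\<exists>tri br. is_tensor_triangle \<D> dia tri \<and> is_tensor_bracket \<D> dia br) \<and>
    (\<forall>tri br. is_tensor_triangle \<D> dia tri \<and> is_tensor_bracket \<D> dia br \<longrightarrow>
      post_Lie_algebra (tensor_space UNIV \<D>) tri br)"
proof -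
  have lin: "linear D" if "D \<in> \<D>" for D
    using assms(2) that by (auto simp: Der_def)
  have Lie: "Lie_algebra \<D> (commutator (\<circ>))"
    using assms(1,3) lin by (intro Lie_algebra_endomorphisms)
  have base: "post_Lie_algebra \<D> dia (\<lambda>D E. commutator (\<circ>) D E - commutator dia D E)"
    using Lie assms(4-6) by (rule post_Lie_algebra_flat_parallel_torsion)
  interpret base: post_Lie_algebra \<D> dia "\<lambda>D E. commutator (\<circ>) D E - commutator dia D E"
    by (fact base)
  show ?thesis
    using ex_tensor_triangle[OF assms(1) lin assms(4)] ex_tensor_bracket[OF assms(1) base.bracket_bilinear]
      post_Lie_algebra_tensor_space[OF assms(2) base] by blast
qed

end
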